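(* Let $G=(V,E)$ be a finite graph, $\ell\colon E\to(0,+\infty)$ an edge length function and $\Gamma$ the corresponding metric graph. Let $D$ be a divisor on $\Gamma$ and let $h$ be a rational function on $\Gamma$ such that $\mathrm{div}(h)+D$ is $G$-admissible. Let $h'$ be a rational function on $\Gamma$ such that $\mathrm{div}(h')+D$ is effective outside the set of vertices of $G$. The following are equivalent: (1) $h'(v)\ge h(v)$ for all $v\in V$. (2) $h'(x)\ge h(x)$ for all $x\in\Gamma$. Moreover, the inequalities in (1) are all strict if and only if so are the inequalities in (2).
   Context: The metric graph $\Gamma$ is obtained from $G$ by replacing each edge $e$ by an interval of length $\ell(e)$. A divisor on $\Gamma$ is a finite formal sum $D=\sum_{x\in\Gamma}D(x)(x)$, $D(x)\in\mathbb{Z}$. It is effective outside $V$ if $D(x)\ge0$ for all $x\in\Gamma\setminus V$. It is $G$-admissible if for each edge $e$ of $G$, $D$ vanishes at every point of the interior of $e$ with at most one exception $x$, for which $D(x)=1$. A rational function on $\Gamma$ is a continuous function $\Gamma\to\mathbb{R}$ whose restriction to each edge is piecewise affine with integral slopes. $\mathrm{div}(f)=\sum_x\mathrm{ord}_x(f)(x)$, where $\mathrm{ord}_x(f)$ is the sum of the incoming slopes of $f$ at $x$ (the incoming slope along a tangent direction at $x$ is the slope when moving towards $x$, i.e. minus the outgoing slope). *)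

theory Defs
  imports "HOL-Analysis.Analysis" "Graph_Theory.Digraph"
begin

text \<open>
  A finite graph, loops and multiple edges allowed, is a \<^locale>\<open>fin_digraph\<close>: the arcs are the
  edges, each with an arbitrary orientation that serves only to parametrise it.

  Points of the metric graph: the vertices, and for every edge \<open>e\<close> the points \<open>Interior e t\<close>
  at distance \<open>t\<close> from the tail of \<open>e\<close>, where \<open>0 < t < l e\<close>.
\<close>

datatype ('v, 'e) mg_point = Vertex 'v | Interior 'e real

definition edge_interior :: "('e \<Rightarrow> real) \<Rightarrow> 'e \<Rightarrow> ('v, 'e) mg_point set" where
  "edge_interior l e = {Interior e t |t. 0 < t \<and> t < l e}"

definition metric_graph :: "('v, 'e) pre_digraph \<Rightarrow> ('e \<Rightarrow> real) \<Rightarrow> ('v, 'e) mg_point set" where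
  "metric_graph G l = Vertex ` verts G \<union> (\<Union>e\<in>arcs G. edge_interior l e)"

text \<open>
  The map from \<open>{0..l e}\<close> onto the closed edge \<open>e\<close>. It identifies the two end points if \<open>e\<close> is
  a loop.
\<close>

definition edge_map ::
  "('v, 'e) pre_digraph \<Rightarrow> ('e \<Rightarrow> real) \<Rightarrow> 'e \<Rightarrow> real \<Rightarrow> ('v, 'e) mg_point" where
  "edge_map G l e t =
     (if t \<le> 0 then Vertex (tail G e) else if t \<ge> l e then Vertex (head G e) else Interior e t)"

text \<open>
  The quotient topology on the disjoint union of the discrete set of vertices and of the
  intervals \<open>{0..l e}\<close>, with the end points of the intervals glued to the vertices.
\<close>

definition mg_topology ::
  "('v, 'e) pre_digraph \<Rightarrow> ('e \<Rightarrow> real) \<Rightarrow> ('v, 'e) mg_point topology" where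
  "mg_topology G l = topology (\<lambda>U. U \<subseteq> metric_graph G l \<and>
     (\<forall>e\<in>arcs G. openin (top_of_set {0..l e}) {t \<in> {0..l e}. edge_map G l e t \<in> U}))"

lemma openin_mg_topology:
  "openin (mg_topology G l) U \<longleftrightarrow> U \<subseteq> metric_graph G l \<and>
     (\<forall>e\<in>arcs G. openin (top_of_set {0..l e}) {t \<in> {0..l e}. edge_map G l e t \<in> U})"
proof -
  have "istopology (\<lambda>U. U \<subseteq> metric_graph G l \<and>
     (\<forall>e\<in>arcs G. openin (top_of_set {0..l e}) {t \<in> {0..l e}. edge_map G l e t \<in> U}))"
    (is "istopology ?P")
    unfolding istopology_def
  proof (rule conjI; (rule allI | rule impI)+)
    fix S T assume "?P S" "?P T"
    moreover have "{t \<in> {0..l e}. edge_map G l e t \<in> S \<inter> T} =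
      {t \<in> {0..l e}. edge_map G l e t \<in> S} \<inter> {t \<in> {0..l e}. edge_map G l e t \<in> T}" for e
      by auto
    ultimately show "?P (S \<inter> T)"
      by (auto intro: openin_Int)
  next
    fix K assume K: "\<forall>S\<in>K. ?P S"
    have eq: "{t \<in> {0..l e}. edge_map G l e t \<in> \<Union>K} =
      \<Union>((\<lambda>S. {t \<in> {0..l e}. edge_map G l e t \<in> S}) ` K)" for e
      by auto
    show "?P (\<Union>K)"
    proof (intro conjI ballI)
      show "\<Union>K \<subseteq> metric_graph G l"
        using K by blast
      fix e assume "e \<in> arcs G"
      with K show "openin (top_of_set {0..l e}) {t \<in> {0..l e}. edge_map G l e t \<in> \<Union>K}"
        unfolding eq by (intro openin_Union) fast
    qed
  qed
  then show ?thesis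
    unfolding mg_topology_def by (simp add: topology_inverse')
qed

lemma edge_map_in_metric_graph:
  assumes "wf_digraph G" "e \<in> arcs G" "0 \<le> t" "t \<le> l e"
  shows "edge_map G l e t \<in> metric_graph G l"
  using assms
  by (auto simp: edge_map_def metric_graph_def edge_interior_def
      wf_digraph.tail_in_verts wf_digraph.head_in_verts)

lemma topspace_mg_topology:
  assumes "wf_digraph G"
  shows "topspace (mg_topology G l) = metric_graph G l"
proof -
  have eq: "{t \<in> {0..l e}. edge_map G l e t \<in> metric_graph G l} = {0..l e}"
    if "e \<in> arcs G" for e
    using edge_map_in_metric_graph[OF assms that] by auto
  have "openin (mg_topology G l) (metric_graph G l)"
    unfolding openin_mg_topology
  proof (intro conjI ballI order_refl)
    fix e assume "e \<in> arcs G"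
    show "openin (top_of_set {0..l e}) {t \<in> {0..l e}. edge_map G l e t \<in> metric_graph G l}"
      unfolding eq[OF \<open>e \<in> arcs G\<close>] by (rule openin_subtopology_self)
  qed
  then show ?thesis
    unfolding topspace_def openin_mg_topology by blast
qed

text \<open>
  A divisor \<open>\<Sum>\<^sub>x D(x) (x)\<close> is given by its coefficient function, extended by \<open>0\<close> outside
  the metric graph.
\<close>

definition mg_divisor ::
  "('v, 'e) pre_digraph \<Rightarrow> ('e \<Rightarrow> real) \<Rightarrow> (('v, 'e) mg_point \<Rightarrow> int) \<Rightarrow> bool" where
  "mg_divisor G l D \<longleftrightarrow> finite {x. D x \<noteq> 0} \<and> {x. D x \<noteq> 0} \<subseteq> metric_graph G l"

definition effective_outside_verts ::
  "('v, 'e) pre_digraph \<Rightarrow> ('e \<Rightarrow> real) \<Rightarrow> (('v, 'e) mg_point \<Rightarrow> int) \<Rightarrow> bool" where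
  "effective_outside_verts G l D \<longleftrightarrow>
     (\<forall>x \<in> metric_graph G l - Vertex ` verts G. D x \<ge> 0)"

definition admissible ::
  "('v, 'e) pre_digraph \<Rightarrow> ('e \<Rightarrow> real) \<Rightarrow> (('v, 'e) mg_point \<Rightarrow> int) \<Rightarrow> bool" where
  "admissible G l D \<longleftrightarrow> (\<forall>e\<in>arcs G.
     (\<forall>x\<in>edge_interior l e. D x = 0) \<or>
     (\<exists>x\<in>edge_interior l e. D x = 1 \<and> (\<forall>y\<in>edge_interior l e - {x}. D y = 0)))"

definition piecewise_affine_int :: "real \<Rightarrow> (real \<Rightarrow> real) \<Rightarrow> bool" where
  "piecewise_affine_int L g \<longleftrightarrow> (\<exists>n a. a 0 = 0 \<and> a n = L \<and>
     (\<forall>i<n. a i < a (Suc i) \<and>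
        (\<exists>(k::int) c. \<forall>t\<in>{a i..a (Suc i)}. g t = of_int k * t + c)))"

text \<open>The values of \<open>f\<close> outside the metric graph are irrelevant.\<close>

definition rational_function ::
  "('v, 'e) pre_digraph \<Rightarrow> ('e \<Rightarrow> real) \<Rightarrow> (('v, 'e) mg_point \<Rightarrow> real) \<Rightarrow> bool" where
  "rational_function G l f \<longleftrightarrow> continuous_map (mg_topology G l) euclideanreal f \<and>
     (\<forall>e\<in>arcs G. piecewise_affine_int (l e) (f \<circ> edge_map G l e))"

text \<open>
  A tangent direction at \<open>x\<close> is a triple \<open>(e, t, s)\<close> such that \<open>x\<close> is the point with parameter
  \<open>t\<close> on \<open>e\<close>; moving away from \<open>x\<close> in this direction increases the parameter if \<open>s = 1\<close> and
  decreases it if \<open>s = -1\<close>. A loop thus contributes two directions at its vertex.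
\<close>

definition tangent_directions ::
  "('v, 'e) pre_digraph \<Rightarrow> ('e \<Rightarrow> real) \<Rightarrow> ('v, 'e) mg_point \<Rightarrow> ('e \<times> real \<times> real) set" where
  "tangent_directions G l x = {(e, t, s). e \<in> arcs G \<and> t \<in> {0..l e} \<and> edge_map G l e t = x \<and>
     (s = 1 \<and> t < l e \<or> s = -1 \<and> 0 < t)}"

fun incoming_slope ::
  "('v, 'e) pre_digraph \<Rightarrow> ('e \<Rightarrow> real) \<Rightarrow> (('v, 'e) mg_point \<Rightarrow> real) \<Rightarrow> 'e \<times> real \<times> real \<Rightarrow> int"
where
  "incoming_slope G l f (e, t, s) = (THE k. \<forall>\<^sub>F u in at_right 0.
     f (edge_map G l e (t + s * u)) = f (edge_map G l e t) - of_int k * u)"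

definition ord_at ::
  "('v, 'e) pre_digraph \<Rightarrow> ('e \<Rightarrow> real) \<Rightarrow> (('v, 'e) mg_point \<Rightarrow> real) \<Rightarrow> ('v, 'e) mg_point \<Rightarrow> int"
where
  "ord_at G l f x = (\<Sum>d\<in>tangent_directions G l x. incoming_slope G l f d)"

definition principal_divisor ::
  "('v, 'e) pre_digraph \<Rightarrow> ('e \<Rightarrow> real) \<Rightarrow> (('v, 'e) mg_point \<Rightarrow> real) \<Rightarrow> ('v, 'e) mg_point \<Rightarrow> int"
where
  "principal_divisor G l f x = (if x \<in> metric_graph G l then ord_at G l f x else 0)"

text \<open>
  The remaining lemmas show that these notions are well defined: the sum in \<^const>\<open>ord_at\<close> is
  finite, the incoming slopes exist uniquely, and \<^const>\<open>principal_divisor\<close> is a divisor.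
\<close>

lemma finite_tangent_directions:
  assumes "fin_digraph G"
  shows "finite (tangent_directions G l x)"
proof (rule finite_subset)
  let ?T = "\<lambda>e. {0, l e} \<union> (case x of Vertex _ \<Rightarrow> {} | Interior _ t \<Rightarrow> {t})"
  show "tangent_directions G l x \<subseteq> (\<Union>e\<in>arcs G. {e} \<times> ?T e \<times> {1, -1})"
    by (auto simp: tangent_directions_def edge_map_def split: if_splits)
  show "finite (\<Union>e\<in>arcs G. {e} \<times> ?T e \<times> {1, -1})"
    using assms by (auto simp: fin_digraph.finite_arcs split: mg_point.split)
qed

lemma incoming_slope_eqI:
  assumes "\<forall>\<^sub>F u in at_right 0.
    f (edge_map G l e (t + s * u)) = f (edge_map G l e t) - of_int k * u"
  shows "incoming_slope G l f (e, t, s) = k"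
proof -
  have "k' = k" if "\<forall>\<^sub>F u in at_right 0.
    f (edge_map G l e (t + s * u)) = f (edge_map G l e t) - of_int k' * u" for k'
  proof -
    have "\<forall>\<^sub>F u::real in at_right 0. k' = k"
      using that assms eventually_at_right_less[of "0::real"]
      by eventually_elim auto
    then show ?thesis by simp
  qed
  then show ?thesis
    unfolding incoming_slope.simps using assms by (rule the_equality[rotated])
qed

lemma piecewise_pieceE:
  fixes a :: "nat \<Rightarrow> real"
  assumes "a 0 \<le> t" "t < a n"
  obtains i where "i < n" "a i \<le> t" "t < a (Suc i)"
proof -
  define m where "m = (LEAST i. t < a i)"
  have m: "t < a m" "m \<le> n"
    unfolding m_def using assms(2) by (auto intro: LeastI Least_le)
  with assms(1) obtain i where i: "m = Suc i" by (cases m) auto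
  have "\<not> t < a i" using i not_less_Least[of i "\<lambda>i. t < a i"] m_def by auto
  with that[of i] i m show thesis by auto
qed

lemma piecewise_pieceE':
  fixes a :: "nat \<Rightarrow> real"
  assumes "a 0 < t" "t \<le> a n"
  obtains i where "i < n" "a i < t" "t \<le> a (Suc i)"
proof -
  define m where "m = (LEAST i. t \<le> a i)"
  have m: "t \<le> a m" "m \<le> n"
    unfolding m_def using assms(2) by (auto intro: LeastI Least_le)
  with assms(1) obtain i where i: "m = Suc i" by (cases m) auto
  have "\<not> t \<le> a i" using i not_less_Least[of i "\<lambda>i. t \<le> a i"] m_def by auto
  with that[of i] i m show thesis by auto
qed

lemma incoming_slope_affine_right:
  assumes "\<forall>r\<in>{p..q}. (f \<circ> edge_map G l e) r = of_int k * r + c" "p \<le> t" "t < q"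
  shows "\<forall>\<^sub>F u in at_right 0.
    f (edge_map G l e (t + 1 * u)) = f (edge_map G l e t) - of_int (- k) * u"
proof -
  have "\<forall>\<^sub>F u in at_right 0. u \<in> {0<..<q - t}"
    using assms by (intro eventually_at_right_real) auto
  then show ?thesis
    by eventually_elim (use assms in \<open>auto simp: algebra_simps\<close>)
qed

lemma incoming_slope_affine_left:
  assumes "\<forall>r\<in>{p..q}. (f \<circ> edge_map G l e) r = of_int k * r + c" "p < t" "t \<le> q"
  shows "\<forall>\<^sub>F u in at_right 0.
    f (edge_map G l e (t + - 1 * u)) = f (edge_map G l e t) - of_int k * u"
proof -
  have "\<forall>\<^sub>F u in at_right 0. u \<in> {0<..<t - p}"
    using assms by (intro eventually_at_right_real) auto
  then show ?thesis
    by eventually_elim (use assms in \<open>auto simp: algebra_simps\<close>)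
qed

lemma incoming_slope_exists:
  assumes "rational_function G l f" "(e, t, s) \<in> tangent_directions G l x"
  shows "\<forall>\<^sub>F u in at_right 0. f (edge_map G l e (t + s * u)) =
    f (edge_map G l e t) - of_int (incoming_slope G l f (e, t, s)) * u"
proof -
  have d: "e \<in> arcs G" "t \<in> {0..l e}" "s = 1 \<and> t < l e \<or> s = -1 \<and> 0 < t"
    using assms(2) by (auto simp: tangent_directions_def)
  obtain n a where a: "a 0 = 0" "a n = l e"
    "\<And>i. i < n \<Longrightarrow> \<exists>(k::int) c. \<forall>r\<in>{a i..a (Suc i)}. (f \<circ> edge_map G l e) r = of_int k * r + c"
    using assms(1) d(1) unfolding rational_function_def piecewise_affine_int_def by blast
  have "\<exists>k. \<forall>\<^sub>F u in at_right 0. f (edge_map G l e (t + s * u)) =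
    f (edge_map G l e t) - of_int k * u" (is "\<exists>k. ?P k")
    using d(3)
  proof (elim disjE conjE)
    assume s: "s = 1" "t < l e"
    obtain i where i: "i < n" "a i \<le> t" "t < a (Suc i)"
      using piecewise_pieceE[of a t n] a d(2) s by auto
    with a(3)[of i] show ?thesis
      unfolding s(1) by (blast intro: incoming_slope_affine_right)
  next
    assume s: "s = -1" "0 < t"
    obtain i where i: "i < n" "a i < t" "t \<le> a (Suc i)"
      using piecewise_pieceE'[of a t n] a d(2) s by auto
    with a(3)[of i] show ?thesis
      unfolding s(1) by (blast intro: incoming_slope_affine_left)
  qed
  then obtain k where "?P k" ..
  with incoming_slope_eqI[OF this] show ?thesis
    by (simp only:)
qed

lemma mg_divisor_principal_divisor:
  assumes "fin_digraph G" "rational_function G l f"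
  shows "mg_divisor G l (principal_divisor G l f)"
proof -
  have "\<exists>B. finite B \<and> (\<forall>t. 0 < t \<and> t < l e \<and> t \<notin> B \<longrightarrow> ord_at G l f (Interior e t) = 0)"
    if e: "e \<in> arcs G" for e
  proof -
    obtain n a where a: "a 0 = 0" "a n = l e"
      "\<And>i. i < n \<Longrightarrow> \<exists>(k::int) c. \<forall>r\<in>{a i..a (Suc i)}. (f \<circ> edge_map G l e) r = of_int k * r + c"
      using assms(2) e unfolding rational_function_def piecewise_affine_int_def by blast
    have "ord_at G l f (Interior e t) = 0" if t: "0 < t" "t < l e" "t \<notin> a ` {..n}" for t
    proof -
      have dirs: "tangent_directions G l (Interior e t) = {(e, t, 1), (e, t, -1)}"
        using e t by (auto simp: tangent_directions_def edge_map_def split: if_splits)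
      obtain i where i: "i < n" "a i \<le> t" "t < a (Suc i)"
        using piecewise_pieceE[of a t n] a t by auto
      have "a i < t" using i t(3) by (metis atMost_iff imageI less_imp_le order_le_less)
      obtain k :: int and c where
        kc: "\<forall>r\<in>{a i..a (Suc i)}. (f \<circ> edge_map G l e) r = of_int k * r + c"
        using a(3)[OF i(1)] by blast
      have "incoming_slope G l f (e, t, 1) = - k" "incoming_slope G l f (e, t, -1) = k"
        using incoming_slope_affine_right[OF kc, of t] incoming_slope_affine_left[OF kc, of t]
          i \<open>a i < t\<close> by (auto intro!: incoming_slope_eqI simp del: incoming_slope.simps)
      then show ?thesis
        unfolding ord_at_def dirs by (simp del: incoming_slope.simps)
    qed
    then show ?thesis by (intro exI[of _ "a ` {..n}"]) auto
  qed
  then obtain B where B: "\<And>e. e \<in> arcs G \<Longrightarrow> finite (B e)"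
    "\<And>e t. e \<in> arcs G \<Longrightarrow> 0 < t \<Longrightarrow> t < l e \<Longrightarrow> t \<notin> B e \<Longrightarrow> ord_at G l f (Interior e t) = 0"
    by metis
  have "{x. principal_divisor G l f x \<noteq> 0} \<subseteq> Vertex ` verts G \<union> (\<Union>e\<in>arcs G. Interior e ` B e)"
    using B(2)
    by (fastforce simp: principal_divisor_def metric_graph_def edge_interior_def split: if_splits)
  moreover have "finite (Vertex ` verts G \<union> (\<Union>e\<in>arcs G. Interior e ` B e))"
    using assms(1) B(1) by (auto simp: fin_digraph.finite_arcs fin_digraph.finite_verts)
  ultimately have "finite {x. principal_divisor G l f x \<noteq> 0}"
    by (rule finite_subset)
  moreover have "{x. principal_divisor G l f x \<noteq> 0} \<subseteq> metric_graph G l"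
    by (auto simp: principal_divisor_def)
  ultimately show ?thesis
    unfolding mg_divisor_def by blast
qed

end

theory Submission
  imports Defs
begin

text \<open>
  On an edge, put \<open>g = h' - h\<close>. At an interior point the sum of the two incoming slopes of \<open>g\<close> is
  the coefficient of \<open>(div(h') + D) - (div(h) + D)\<close>, so it is nonnegative, except that it may be
  \<open>-1\<close> at a single point \<open>c\<close>. If the minimum of \<open>g\<close> on the edge were smaller than both end
  values, then the first and the last point where it is attained would be interior. The outer
  incoming slope at such a point is negative, hence at most \<open>-1\<close> by integrality, and the inner one
  is at most \<open>0\<close>. The sum is therefore negative, so both points are equal to \<open>c\<close>; but then both
  incoming slopes at \<open>c\<close> are at most \<open>-1\<close> and their sum is at most \<open>-2\<close>, a contradiction. So \<open>g\<close>
  is bounded below on every edge by the smaller of its two end values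
  (\<open>min_ends_le_of_incoming_slopes\<close> and \<open>min_ends_le_on_edge\<close>), and both equivalences follow,
  since every vertex is a point of the metric graph.
\<close>

text \<open>
  In the next two lemmas the sign \<open>s\<close> selects the side from which the minimum point \<open>p\<close> is
  approached. The second lemma is where integrality enters: it improves \<open>k < 0\<close> to \<open>k \<le> -1\<close>.
\<close>

lemma incoming_slope_at_minimum:
  fixes g :: "real \<Rightarrow> real" and k :: int
  assumes "\<forall>\<^sub>F u in at_right 0. g (p + s * u) = g p - of_int k * u"
    and "\<forall>\<^sub>F u in at_right 0. g p \<le> g (p + s * u)"
  shows "k \<le> 0"
proof -
  have "\<forall>\<^sub>F u::real in at_right 0. k \<le> 0"
    using assms eventually_at_right_less[of "0::real"]
    by eventually_elim (auto simp: mult_le_0_iff)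
  then show ?thesis by simp
qed

lemma incoming_slope_at_strict_minimum:
  fixes g :: "real \<Rightarrow> real" and k :: int
  assumes "\<forall>\<^sub>F u in at_right 0. g (p + s * u) = g p - of_int k * u"
    and "\<forall>\<^sub>F u in at_right 0. g p < g (p + s * u)"
  shows "k \<le> -1"
proof -
  have "\<forall>\<^sub>F u::real in at_right 0. k < 0"
    using assms eventually_at_right_less[of "0::real"]
    by eventually_elim (auto simp: mult_less_0_iff)
  then show ?thesis by simp
qed

text \<open>
  A convex kink of slope change \<open>1\<close> is harmless because the slopes are integers: a valley whose
  bottom is strictly below both ends needs a slope change of at least \<open>2\<close>, spread over its first
  and its last lowest point.
\<close>

lemma min_ends_le_of_incoming_slopes:
  fixes g :: "real \<Rightarrow> real" and A B :: "real \<Rightarrow> int"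
  assumes cont: "continuous_on {0..L} g"
    and right: "\<And>t. 0 < t \<Longrightarrow> t < L \<Longrightarrow>
      \<forall>\<^sub>F u in at_right 0. g (t + 1 * u) = g t - of_int (A t) * u"
    and left: "\<And>t. 0 < t \<Longrightarrow> t < L \<Longrightarrow>
      \<forall>\<^sub>F u in at_right 0. g (t + -1 * u) = g t - of_int (B t) * u"
    and ord: "\<And>t. 0 < t \<Longrightarrow> t < L \<Longrightarrow> A t + B t \<ge> (if t = c then -1 else 0)"
    and t: "t \<in> {0..L}"
  shows "min (g 0) (g L) \<le> g t"
proof (rule ccontr)
  assume neg: "\<not> min (g 0) (g L) \<le> g t"
  obtain m where m: "m \<in> {0..L}" "\<And>r. r \<in> {0..L} \<Longrightarrow> g m \<le> g r"
    using continuous_attains_inf[OF compact_Icc _ cont] t by blast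
  have ends: "g m < g 0" "g m < g L"
    using neg m(2)[OF t] by auto
  define Z where "Z = {r \<in> {0..L}. g r = g m}"
  have "Z \<noteq> {}"
    using m(1) by (auto simp: Z_def)
  have "closed Z"
    using continuous_closed_preimage_constant[OF cont closed_atLeastAtMost] by (simp add: Z_def)
  then have "compact ({0..L} \<inter> Z)"
    by (intro compact_Int_closed compact_Icc)
  moreover have "{0..L} \<inter> Z = Z"
    by (auto simp: Z_def)
  ultimately have Z: "compact Z" "Z \<noteq> {}"
    using \<open>Z \<noteq> {}\<close> by auto
  \<comment> \<open>\<open>g\<close> exceeds its minimum strictly to the left of \<open>p\<close> and strictly to the right of \<open>q\<close>.\<close>
  obtain p where p: "p \<in> Z" "\<And>r. r \<in> Z \<Longrightarrow> p \<le> r"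
    using compact_attains_inf[OF Z] by blast
  obtain q where q: "q \<in> Z" "\<And>r. r \<in> Z \<Longrightarrow> r \<le> q"
    using compact_attains_sup[OF Z] by blast
  have minimum: "0 < r" "r < L" "A r \<le> 0" "B r \<le> 0" if "r \<in> Z" for r
  proof -
    show r: "0 < r" "r < L"
      using that ends by (auto simp: Z_def less_le)
    have "\<forall>\<^sub>F u in at_right 0. u \<in> {0<..<min r (L - r)}"
      using r by (intro eventually_at_right_real) auto
    then have ge: "\<forall>\<^sub>F u in at_right 0. g r \<le> g (r + s * u)" if "s = 1 \<or> s = -1" for s
      by eventually_elim (use that m(2) \<open>r \<in> Z\<close> in \<open>auto simp: Z_def\<close>)
    show "A r \<le> 0"
      by (rule incoming_slope_at_minimum[OF right[OF r] ge]) simp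
    show "B r \<le> 0"
      by (rule incoming_slope_at_minimum[OF left[OF r] ge]) simp
  qed
  have "B p \<le> -1"
  proof (rule incoming_slope_at_strict_minimum[OF left])
    have "\<forall>\<^sub>F u in at_right 0. u \<in> {0<..<p}"
      using minimum(1)[OF p(1)] by (rule eventually_at_right_real)
    then show "\<forall>\<^sub>F u in at_right 0. g p < g (p + -1 * u)"
    proof eventually_elim
      case (elim u)
      then have "p - u \<in> {0..L}" "p - u \<notin> Z"
        using p(1) p(2)[of "p - u"] by (auto simp: Z_def)
      then show ?case
        using m(2)[of "p - u"] p(1) by (auto simp: Z_def)
    qed
  qed (use minimum[OF p(1)] in auto)
  have "A q \<le> -1"
  proof (rule incoming_slope_at_strict_minimum[OF right])
    have "\<forall>\<^sub>F u in at_right 0. u \<in> {0<..<L - q}"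
      using minimum(2)[OF q(1)] by (intro eventually_at_right_real) simp
    then show "\<forall>\<^sub>F u in at_right 0. g q < g (q + 1 * u)"
    proof eventually_elim
      case (elim u)
      then have "q + u \<in> {0..L}" "q + u \<notin> Z"
        using q(1) q(2)[of "q + u"] by (auto simp: Z_def)
      then show ?case
        using m(2)[of "q + u"] q(1) by (auto simp: Z_def)
    qed
  qed (use minimum[OF q(1)] in auto)
  have "p = c"
    using \<open>B p \<le> -1\<close> minimum[OF p(1)] ord[of p] by (auto split: if_splits)
  moreover have "q = c"
    using \<open>A q \<le> -1\<close> minimum[OF q(1)] ord[of q] by (auto split: if_splits)
  ultimately show False
    using \<open>B p \<le> -1\<close> \<open>A q \<le> -1\<close> minimum[OF p(1)] ord[of c] by auto
qed

lemma continuous_map_edge_map: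
  assumes "wf_digraph G" "e \<in> arcs G"
  shows "continuous_map (top_of_set {0..l e}) (mg_topology G l) (edge_map G l e)"
  using assms
  by (auto simp: continuous_map_def topspace_mg_topology edge_map_in_metric_graph
      openin_mg_topology)

lemma continuous_on_edge:
  assumes "wf_digraph G" "rational_function G l f" "e \<in> arcs G"
  shows "continuous_on {0..l e} (\<lambda>t. f (edge_map G l e t))"
  using continuous_map_compose[OF continuous_map_edge_map[OF assms(1,3), of l], of euclideanreal f]
    assms(2)
  by (simp add: rational_function_def comp_def)

lemma tangent_directions_interior:
  assumes "e \<in> arcs G" "0 < t" "t < l e"
  shows "tangent_directions G l (Interior e t) = {(e, t, 1), (e, t, -1)}"
  using assms by (auto simp: tangent_directions_def edge_map_def split: if_splits)

lemma principal_divisor_interior: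
  assumes "e \<in> arcs G" "0 < t" "t < l e"
  shows "principal_divisor G l f (Interior e t) =
    incoming_slope G l f (e, t, 1) + incoming_slope G l f (e, t, -1)"
  using assms
  by (auto simp: principal_divisor_def ord_at_def tangent_directions_interior metric_graph_def
      edge_interior_def simp del: incoming_slope.simps)

text \<open>
  This passes from divisors to slopes: \<open>D\<close> cancels in the difference of the two coefficients, one
  of which is nonnegative, the other one at most \<open>0\<close> except for a possible \<open>1\<close> at a single point.
\<close>

lemma min_ends_le_on_edge:
  fixes h h' :: "('v, 'e) mg_point \<Rightarrow> real"
  assumes "wf_digraph G" "e \<in> arcs G"
    and h: "rational_function G l h" "admissible G l (\<lambda>x. principal_divisor G l h x + D x)"
    and h': "rational_function G l h'"
      "effective_outside_verts G l (\<lambda>x. principal_divisor G l h' x + D x)"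
    and t: "t \<in> {0..l e}"
  defines "g \<equiv> \<lambda>r. h' (edge_map G l e r) - h (edge_map G l e r)"
  shows "min (g 0) (g (l e)) \<le> g t"
proof -
  define slope where
    "slope s r = incoming_slope G l h' (e, r, s) - incoming_slope G l h (e, r, s)" for r s
  have slope: "\<forall>\<^sub>F u in at_right 0. g (r + s * u) = g r - of_int (slope s r) * u"
    if r: "0 < r" "r < l e" and "s = 1 \<or> s = -1" for r s
  proof -
    have d: "(e, r, s) \<in> tangent_directions G l (Interior e r)"
      using tangent_directions_interior[of e G r l] assms(2) that by auto
    show ?thesis
      using incoming_slope_exists[OF h'(1) d] incoming_slope_exists[OF h(1) d]
      by eventually_elim (simp add: g_def slope_def algebra_simps del: incoming_slope.simps)
  qed
  obtain c where c: "\<And>r. 0 < r \<Longrightarrow> r < l e \<Longrightarrow>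
    principal_divisor G l h (Interior e r) + D (Interior e r) \<le> (if r = c then 1 else 0)"
  proof -
    consider "\<forall>x\<in>edge_interior l e. principal_divisor G l h x + D x = 0"
      | c where "principal_divisor G l h (Interior e c) + D (Interior e c) = 1"
        "\<forall>y\<in>edge_interior l e - {Interior e c}. principal_divisor G l h y + D y = 0"
      using h(2) assms(2) unfolding admissible_def edge_interior_def by fast
    then show thesis
    proof cases
      case 1
      \<comment> \<open>No exceptional point: any \<open>c\<close> will do, here one outside the open edge.\<close>
      then show thesis by (intro that[of 0]) (auto simp: edge_interior_def)
    next
      case 2
      then show thesis by (intro that[of c]) (auto simp: edge_interior_def)
    qed
  qed
  have ord: "slope 1 r + slope (-1) r \<ge> (if r = c then -1 else 0)" if r: "0 < r" "r < l e" for r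
  proof -
    have "Interior e r \<in> metric_graph G l - Vertex ` verts G"
      using assms(2) r by (auto simp: metric_graph_def edge_interior_def)
    then have "0 \<le> principal_divisor G l h' (Interior e r) + D (Interior e r)"
      using h'(2) unfolding effective_outside_verts_def by blast
    then show ?thesis
      using c[OF r] principal_divisor_interior[where G = G and l = l, OF assms(2) r]
      by (auto simp: slope_def simp del: incoming_slope.simps split: if_splits)
  qed
  have "continuous_on {0..l e} g"
    unfolding g_def using assms(1,2) h(1) h'(1)
    by (intro continuous_on_diff continuous_on_edge)
  then show ?thesis
    using slope ord t
    by (intro min_ends_le_of_incoming_slopes[where A = "slope 1" and B = "slope (-1)" and c = c])
      blast+
qed

lemma min_verts_le_interior:
  fixes h h' :: "('v, 'e) mg_point \<Rightarrow> real"
  assumes "wf_digraph G" "e \<in> arcs G"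
    and "rational_function G l h" "admissible G l (\<lambda>x. principal_divisor G l h x + D x)"
    and "rational_function G l h'"
      "effective_outside_verts G l (\<lambda>x. principal_divisor G l h' x + D x)"
    and "0 < t" "t < l e"
  shows "min (h' (Vertex (tail G e)) - h (Vertex (tail G e)))
      (h' (Vertex (head G e)) - h (Vertex (head G e))) \<le> h' (Interior e t) - h (Interior e t)"
  using min_ends_le_on_edge[OF assms(1-6), of t] assms(7,8) by (simp add: edge_map_def)

theorem lemma5p1:
  fixes G :: "('v, 'e) pre_digraph"
    and l :: "'e \<Rightarrow> real"
    and D :: "('v, 'e) mg_point \<Rightarrow> int"
    and h h' :: "('v, 'e) mg_point \<Rightarrow> real"
  assumes "fin_digraph G"
    and "\<And>e. e \<in> arcs G \<Longrightarrow> 0 < l e"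
    and "mg_divisor G l D"
    and "rational_function G l h"
    and "admissible G l (\<lambda>x. principal_divisor G l h x + D x)"
    and "rational_function G l h'"
    and "effective_outside_verts G l (\<lambda>x. principal_divisor G l h' x + D x)"
  shows "((\<forall>v\<in>verts G. h' (Vertex v) \<ge> h (Vertex v)) \<longleftrightarrow>
          (\<forall>x\<in>metric_graph G l. h' x \<ge> h x)) \<and>
         ((\<forall>v\<in>verts G. h' (Vertex v) > h (Vertex v)) \<longleftrightarrow>
          (\<forall>x\<in>metric_graph G l. h' x > h x))"
proof -
  have wf: "wf_digraph G"
    using assms(1) by (rule fin_digraph.axioms)
  have bound: "\<exists>v\<in>verts G. h' (Vertex v) - h (Vertex v) \<le> h' x - h x"
    if "x \<in> metric_graph G l" for x
  proof -
    from that consider v where "v \<in> verts G" "x = Vertex v"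
      | e t where "e \<in> arcs G" "0 < t" "t < l e" "x = Interior e t"
      by (auto simp: metric_graph_def edge_interior_def)
    then show ?thesis
    proof cases
      case 1
      then show ?thesis by auto
    next
      case 2
      have "tail G e \<in> verts G" "head G e \<in> verts G"
        using wf 2(1) by (auto intro: wf_digraph.tail_in_verts wf_digraph.head_in_verts)
      then show ?thesis
        using min_verts_le_interior[OF wf 2(1) assms(4-7) 2(2,3)] 2(4)
        by (auto simp: min_le_iff_disj)
    qed
  qed
  have verts: "Vertex v \<in> metric_graph G l" if "v \<in> verts G" for v
    using that by (auto simp: metric_graph_def)
  show ?thesis
    using bound verts by (meson diff_ge_0_iff_ge diff_gt_0_iff_gt order_trans less_le_trans)
qed

end
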